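(* Let $r\in\mathbb{N}$, $\boldsymbol{k}=(k_1,\ldots,k_r),\boldsymbol{l}=(l_1,\ldots,l_r)\in\mathbb{N}^r$ and $\boldsymbol{\sigma},\boldsymbol{\varepsilon}\in\{\pm1\}^r$ with $\varepsilon_1=-1$. Then $$\int_0^1 \omega_0^{k_r}(\omega_{\sigma_r}^{\varepsilon_r})^{l_r}\cdots\omega_0^{k_2}(\omega_{\sigma_2}^{\varepsilon_2})^{l_2}\,\omega_0^{k_1}(\omega_{\sigma_1}^{-1})^{l_1} =\int_0^1 (u_{\sigma_1}^{-1})^{l_1}u_0^{k_1}(u_{\sigma_2}^{\varepsilon_2})^{l_2}u_0^{k_2}\cdots(u_{\sigma_r}^{\varepsilon_r})^{l_r}u_0^{k_r},$$ where $u_0=\omega_{+1}^{-1}$, $u_{+1}^{-1}=\omega_0$, $u_{-1}^{-1}=\omega_{-1}^{-1}$, $u_{+1}^{+1}=\omega_0+\omega_{+1}^{+1}-\omega_{+1}^{-1}$ and $u_{-1}^{+1}=\omega_{+1}^{+1}-\omega_{+1}^{-1}-\omega_{-1}^{+1}$.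
   Context: $\mathbb{N}$ is the set of positive integers. The 1-forms are $\omega_0=\frac{dt}{t}$, $\omega_{+1}^{-1}=\frac{2\,dt}{1-t^2}$, $\omega_{-1}^{-1}=\frac{-2\,dt}{1+t^2}$, $\omega_{+1}^{+1}=\frac{2t\,dt}{1-t^2}$, $\omega_{-1}^{+1}=\frac{-2t\,dt}{1+t^2}$. The iterated integral of a word of 1-forms is $\int_0^1 f_1(t)dt\,f_2(t)dt\cdots f_p(t)dt=\int_{1>t_1>\cdots>t_p>0}f_1(t_1)\cdots f_p(t_p)\,dt_1\cdots dt_p$, extended multilinearly; a power $\omega^k$ in a word means the letter $\omega$ repeated $k$ times. *)

theory Defs
  imports "HOL-Analysis.Analysis"
begin

text \<open>A 1-form \<open>f(t) dt\<close> on \<open>(0,1)\<close> is represented by its density \<open>f\<close>; a word of 1-forms is a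
  list of densities.\<close>

type_synonym form = "real \<Rightarrow> real"

definition omega0 :: form where
  "omega0 t = 1 / t"

text \<open>\<open>omega s e\<close> is \<open>\<omega>\<close> with lower index \<open>s\<close> and upper index \<open>e\<close>; it is meaningful only for
  \<open>s, e \<in> {1, -1}\<close>.\<close>

definition omega :: "int \<Rightarrow> int \<Rightarrow> form" where
  "omega s e t =
    (if s = 1 then (if e = 1 then 2 * t / (1 - t\<^sup>2) else 2 / (1 - t\<^sup>2))
     else (if e = 1 then - 2 * t / (1 + t\<^sup>2) else - 2 / (1 + t\<^sup>2)))"

text \<open>The domain \<open>1 > t\<^sub>1 > \<dots> > t\<^sub>p > 0\<close>, with the variables numbered from \<open>0\<close>.\<close>

definition ordered_simplex :: "nat \<Rightarrow> (nat \<Rightarrow> real) set" where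
  "ordered_simplex p =
    {t \<in> {..<p} \<rightarrow>\<^sub>E {0<..<1}. \<forall>i j. i < j \<longrightarrow> j < p \<longrightarrow> t j < t i}"

definition iter_integral :: "form list \<Rightarrow> real" where
  "iter_integral fs =
    (LINT t : ordered_simplex (length fs) | Pi\<^sub>M {..<length fs} (\<lambda>_. lborel).
      (\<Prod>i<length fs. (fs ! i) (t i)))"

text \<open>\<^const>\<open>iter_integral\<close> takes the value \<open>0\<close> when the integral diverges, so convergence is
  recorded separately. The forms \<^const>\<open>omega0\<close> and \<^const>\<open>omega\<close> have constant sign on \<open>(0,1)\<close>,
  so for words in them convergence and absolute convergence coincide.\<close>

definition iter_convergent :: "form list \<Rightarrow> bool" where
  "iter_convergent fs \<longleftrightarrow>
    set_integrable (Pi\<^sub>M {..<length fs} (\<lambda>_. lborel)) (ordered_simplex (length fs))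
      (\<lambda>t. \<Prod>i<length fs. (fs ! i) (t i))"

text \<open>A formal linear combination of 1-forms is a list of pairs (coefficient, form). The
  multilinear extension expands a word of linear combinations over all ways of choosing one
  summand for each letter, which is what \<^const>\<open>product_lists\<close> enumerates.\<close>

type_synonym lin_form = "(real \<times> form) list"

definition iter_integral_lin :: "lin_form list \<Rightarrow> real" where
  "iter_integral_lin cs =
    (\<Sum>w\<leftarrow>product_lists cs. prod_list (map fst w) * iter_integral (map snd w))"

definition iter_convergent_lin :: "lin_form list \<Rightarrow> bool" where
  "iter_convergent_lin cs \<longleftrightarrow> (\<forall>w\<in>set (product_lists cs). iter_convergent (map snd w))"

definition u0 :: lin_form where
  "u0 = [(1, omega 1 (-1))]"

definition u :: "int \<Rightarrow> int \<Rightarrow> lin_form" where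
  "u s e =
    (if e = 1 then
       (if s = 1 then [(1, omega0), (1, omega 1 1), (-1, omega 1 (-1))]
        else [(1, omega 1 1), (-1, omega 1 (-1)), (-1, omega (-1) 1)])
     else (if s = 1 then [(1, omega0)] else [(1, omega (-1) (-1))]))"

definition lhs_word ::
  "nat \<Rightarrow> (nat \<Rightarrow> nat) \<Rightarrow> (nat \<Rightarrow> nat) \<Rightarrow> (nat \<Rightarrow> int) \<Rightarrow> (nat \<Rightarrow> int) \<Rightarrow> form list" where
  "lhs_word r k l \<sigma> \<epsilon> =
    concat (map (\<lambda>i. replicate (k i) omega0 @ replicate (l i) (omega (\<sigma> i) (\<epsilon> i)))
      (rev [1..<Suc r]))"

definition rhs_word ::
  "nat \<Rightarrow> (nat \<Rightarrow> nat) \<Rightarrow> (nat \<Rightarrow> nat) \<Rightarrow> (nat \<Rightarrow> int) \<Rightarrow> (nat \<Rightarrow> int) \<Rightarrow> lin_form list" where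
  "rhs_word r k l \<sigma> \<epsilon> =
    concat (map (\<lambda>i. replicate (l i) (u (\<sigma> i) (\<epsilon> i)) @ replicate (k i) u0) [1..<Suc r])"

end

theory Submission
  imports Defs
begin

text \<open>The substitution \<open>s = (1 - t) / (1 + t)\<close> is an involution of \<open>(0,1)\<close> which reverses
  the order of the variables and carries each form \<open>\<omega>\<close> to the corresponding \<open>u\<close> (up to the sign
  absorbed by the orientation), so the two sides are the same integral over the simplex once the
  right-hand side is collected by multilinearity. Collecting needs absolute convergence of every
  expanded word, which holds because its first form is regular at \<open>1\<close> and its last at \<open>0\<close>.\<close>

section \<open>Measurability on the simplex and absolute convergence of words\<close>

lemma ordered_simplex_sets [measurable]:
  "ordered_simplex p \<in> sets (Pi\<^sub>M {..<p} (\<lambda>_. lborel))"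
proof -
  have "ordered_simplex p = {t \<in> space (Pi\<^sub>M {..<p} (\<lambda>_. lborel)).
      (\<forall>i\<in>{..<p}. 0 < t i \<and> t i < 1) \<and> (\<forall>i\<in>{..<p}. \<forall>j\<in>{..<p}. i < j \<longrightarrow> t j < t i)}"
    by (auto simp: ordered_simplex_def space_PiM PiE_iff)
  also have "\<dots> \<in> sets (Pi\<^sub>M {..<p} (\<lambda>_. lborel))"
    by measurable
  finally show ?thesis .
qed

lemma ordered_simplexD:
  assumes "t \<in> ordered_simplex p" "i < p"
  shows "0 < t i" "t i < 1"
  using assms by (auto simp: ordered_simplex_def PiE_iff)

lemma measurable_word:
  fixes fs :: "form list"
  assumes "\<And>f. f \<in> set fs \<Longrightarrow> f \<in> borel_measurable borel"
  shows "(\<lambda>t. \<Prod>i<length fs. (fs ! i) (t i)) \<in> borel_measurable (Pi\<^sub>M {..<length fs} (\<lambda>_. lborel))"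
proof (rule borel_measurable_prod)
  fix i assume i: "i \<in> {..<length fs}"
  have "fs ! i \<in> borel_measurable borel"
    using assms i by auto
  then show "(\<lambda>t. (fs ! i) (t i)) \<in> borel_measurable (Pi\<^sub>M {..<length fs} (\<lambda>_. lborel))"
    by (rule measurable_compose[rotated]) (use i in measurable)
qed

text \<open>Splitting \<open>x\<close> into \<open>p\<close> equal factors
  \<open>x powr (1 / p)\<close> reduces the comparison with the geometric mean to one factor at a
  time.\<close>

lemma le_prod_powr:
  fixes x :: real and y :: "nat \<Rightarrow> real"
  assumes "p > 0" "0 < x" "\<And>i. i < p \<Longrightarrow> x \<le> y i"
  shows "x \<le> (\<Prod>i<p. y i powr (1 / p))"
proof -
  have "x = (\<Prod>i<p. x powr (1 / p))"
    using assms by (simp add: powr_realpow[symmetric] powr_powr)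
  also have "\<dots> \<le> (\<Prod>i<p. y i powr (1 / p))"
    using assms by (intro prod_mono conjI powr_mono2) auto
  finally show ?thesis .
qed

text \<open>On the simplex \<open>t\<^sub>p\<close> is at most the geometric mean of all \<open>t\<^sub>i\<close>, and \<open>1 - t\<^sub>1\<close> at most that of
  all \<open>1 - t\<^sub>i\<close>; this distributes the two factors gained at the ends of the word evenly and bounds
  the integrand by a product of Beta integrands with parameter \<open>1 / p\<close>.\<close>

lemma iter_convergentI:
  assumes len: "length fs \<ge> 2"
    and meas: "\<And>f. f \<in> set fs \<Longrightarrow> f \<in> borel_measurable borel"
    and bound: "\<And>f t. f \<in> set fs \<Longrightarrow> 0 < t \<Longrightarrow> t < 1 \<Longrightarrow> \<bar>f t\<bar> \<le> C / (t * (1 - t))"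
    and first: "\<And>t. 0 < t \<Longrightarrow> t < 1 \<Longrightarrow> \<bar>hd fs t\<bar> \<le> C / t"
    and last: "\<And>t. 0 < t \<Longrightarrow> t < 1 \<Longrightarrow> \<bar>last fs t\<bar> \<le> C / (1 - t)"
  shows "iter_convergent fs"
proof -
  interpret product_sigma_finite "\<lambda>_::nat. lborel :: real measure"
    by standard
  define p where "p = length fs"
  define B where "B = (\<lambda>t::real. indicator {0..1} t * (t powr (1 / p - 1) * (1 - t) powr (1 / p - 1)))"
  have p: "p \<ge> 2" "p > 0" using len by (auto simp: p_def)
  have C: "C \<ge> 0" using first[of "1/2"] by simp
  have intB: "integrable lborel B"
    using integrable_Beta[of "1 / p" "1 / p"] p by (simp add: B_def set_integrable_def)
  have "integrable (Pi\<^sub>M {..<p} (\<lambda>_. lborel)) (\<lambda>t. C ^ p * (\<Prod>i<p. B (t i)))"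
    by (intro integrable_mult_right product_integrable_prod intB) auto
  moreover have "(\<lambda>t. indicator (ordered_simplex p) t *\<^sub>R (\<Prod>i<p. (fs ! i) (t i)))
      \<in> borel_measurable (Pi\<^sub>M {..<p} (\<lambda>_. lborel))"
    using measurable_word[OF meas] by (auto simp: p_def intro!: borel_measurable_scaleR)
  moreover have "norm (indicator (ordered_simplex p) t *\<^sub>R (\<Prod>i<p. (fs ! i) (t i)))
      \<le> norm (C ^ p * (\<Prod>i<p. B (t i)))" for t
  proof (cases "t \<in> ordered_simplex p")
    case True
    note t = ordered_simplexD[OF True]
    have Bpos: "B (t i) \<ge> 0" for i
      by (simp add: B_def)
    have mono: "t (p - 1) \<le> t i" "t i \<le> t 0" if "i < p" for i
    proof -
      have le: "t j \<le> t i" if "i \<le> j" "j < p" for i j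
        using True that by (cases "i = j") (auto simp: ordered_simplex_def less_imp_le)
      show "t (p - 1) \<le> t i" "t i \<le> t 0" using that by (auto intro!: le)
    qed
    have B_eq: "B (t i) = (1 - t i) powr (1 / p) * t i powr (1 / p) * (1 / (t i * (1 - t i)))"
      if "i < p" for i
      using t[OF that] by (simp add: B_def powr_diff)
    \<comment> \<open>\<open>d i\<close> is the gain of the \<open>i\<close>-th letter over the
      general bound: the first letter has no pole at 1 and gains \<open>1 - t 0\<close>, the last
      has none at 0 and gains \<open>t (p - 1)\<close>. As \<open>p \<ge> 2\<close>, the two gains
      fall on different letters.\<close>
    define d where "d = (\<lambda>i. (if i = 0 then 1 - t 0 else 1) * (if i = p - 1 then t (p - 1) else 1))"
    have d_prod: "(\<Prod>i<p. d i) = (1 - t 0) * t (p - 1)"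
      unfolding d_def prod.distrib using p by (subst (1 2) prod.delta) auto
    have "\<bar>(fs ! i) (t i)\<bar> \<le> C * (d i / (t i * (1 - t i)))" if i: "i < p" for i
    proof -
      have ft: "0 < t i" "t i < 1" using t i by auto
      consider "i = 0" | "i = p - 1" "i \<noteq> 0" | "i \<noteq> 0" "i \<noteq> p - 1" by blast
      then show ?thesis
      proof cases
        case 1
        have "hd fs = fs ! 0" using p by (simp add: p_def hd_conv_nth flip: length_0_conv)
        then show ?thesis using first[OF ft] 1 p ft by (simp add: d_def)
      next
        case 2
        have "last fs = fs ! (p - 1)" using p by (simp add: p_def last_conv_nth flip: length_0_conv)
        then show ?thesis using last[OF ft] 2 p ft by (simp add: d_def)
      next
        case 3
        have "fs ! i \<in> set fs" using i by (simp add: p_def)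
        then show ?thesis using bound[OF _ ft] 3 by (simp add: d_def)
      qed
    qed
    then have "\<bar>\<Prod>i<p. (fs ! i) (t i)\<bar> \<le> (\<Prod>i<p. C * (d i / (t i * (1 - t i))))"
      unfolding abs_prod by (intro prod_mono) auto
    also have "\<dots> = C ^ p * (((1 - t 0) * t (p - 1)) * (\<Prod>i<p. 1 / (t i * (1 - t i))))"
      unfolding d_prod[symmetric] by (simp add: prod.distrib prod_dividef)
    \<comment> \<open>By \<open>mono\<close>, \<open>t (p - 1)\<close> is the least of the
      \<open>t i\<close> and \<open>1 - t 0\<close> the least of the \<open>1 - t i\<close>, so each
      gain is bounded by a geometric mean.\<close>
    also have "\<dots> \<le> C ^ p * (((\<Prod>i<p. (1 - t i) powr (1 / p)) * (\<Prod>i<p. t i powr (1 / p)))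
        * (\<Prod>i<p. 1 / (t i * (1 - t i))))"
      using t mono p C
      by (intro mult_left_mono mult_right_mono mult_mono le_prod_powr prod_nonneg)
        (auto simp: less_imp_le)
    also have "\<dots> = C ^ p * (\<Prod>i<p. B (t i))"
      unfolding prod.distrib[symmetric] by (simp add: B_eq)
    finally show ?thesis using True C Bpos by (simp add: prod_nonneg abs_mult)
  qed simp
  ultimately have "integrable (Pi\<^sub>M {..<p} (\<lambda>_. lborel))
      (\<lambda>t. indicator (ordered_simplex p) t *\<^sub>R (\<Prod>i<p. (fs ! i) (t i)))"
    by (rule Bochner_Integration.integrable_bound[OF _ _ AE_I2])
  then show ?thesis by (simp add: iter_convergent_def set_integrable_def p_def)
qed

section \<open>Multilinear expansion\<close>

definition lin_density :: "lin_form \<Rightarrow> form" where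
  "lin_density c t = (\<Sum>(a, f)\<leftarrow>c. a * f t)"

lemma sum_list_concat_map:
  fixes g :: "'b \<Rightarrow> 'c::comm_monoid_add"
  shows "(\<Sum>y\<leftarrow>concat (map f xs). g y) = (\<Sum>x\<leftarrow>xs. \<Sum>y\<leftarrow>f x. g y)"
  by (induction xs) auto

text \<open>Distributivity, by induction on the word: expanding the product chooses one summand per
  letter. \<open>t\<close> stays arbitrary because removing the first letter shifts the index of
  each remaining variable by one.\<close>

lemma prod_lin_density:
  "(\<Prod>i<length cs. lin_density (cs ! i) (t i)) =
    (\<Sum>w\<leftarrow>product_lists cs. prod_list (map fst w) * (\<Prod>i<length cs. snd (w ! i) (t i)))"
proof (induction cs arbitrary: t)
  case (Cons c cs)
  have "(\<Prod>i<length (c # cs). lin_density ((c # cs) ! i) (t i)) =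
      lin_density c (t 0) * (\<Prod>i<length cs. lin_density (cs ! i) (t (Suc i)))"
    by (simp add: prod.lessThan_Suc_shift del: prod.lessThan_Suc)
  also have "\<dots> = (\<Sum>x\<leftarrow>c. \<Sum>w\<leftarrow>product_lists cs. (fst x * snd x (t 0)) *
      (prod_list (map fst w) * (\<Prod>i<length cs. snd (w ! i) (t (Suc i)))))"
    by (subst Cons.IH) (simp add: lin_density_def case_prod_unfold sum_list_mult_const
        sum_list_const_mult)
  also have "\<dots> = (\<Sum>w\<leftarrow>product_lists (c # cs).
      prod_list (map fst w) * (\<Prod>i<length (c # cs). snd (w ! i) (t i)))"
    by (simp add: sum_list_concat_map comp_def prod.lessThan_Suc_shift mult_ac
        del: prod.lessThan_Suc)
  finally show ?case .
qed simp

lemma integral_sum_list: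
  fixes f :: "'a \<Rightarrow> 'b \<Rightarrow> real"
  assumes "\<And>x. x \<in> set xs \<Longrightarrow> integrable M (f x)"
  shows "(LINT t|M. (\<Sum>x\<leftarrow>xs. f x t)) = (\<Sum>x\<leftarrow>xs. LINT t|M. f x t)"
    and "integrable M (\<lambda>t. \<Sum>x\<leftarrow>xs. f x t)"
  using assms by (induction xs) auto

text \<open>Sum and integral may be exchanged because each expanded word is integrable on its own; a
  divergent word would enter with the default value 0 and could falsify the identity.\<close>

lemma iter_integral_lin_eq:
  assumes "iter_convergent_lin cs"
  shows "iter_integral_lin cs = iter_integral (map lin_density cs)"
proof -
  define M where "M = Pi\<^sub>M {..<length cs} (\<lambda>_. lborel :: real measure)"
  define S where "S = ordered_simplex (length cs)"
  have intw: "integrable M (\<lambda>t. prod_list (map fst w) *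
      (indicator S t * (\<Prod>i<length cs. snd (w ! i) (t i))))"
    if "w \<in> set (product_lists cs)" for w
  proof -
    have "length w = length cs" using that by (rule in_set_product_lists_length)
    moreover have "iter_convergent (map snd w)"
      using assms that by (simp add: iter_convergent_lin_def)
    ultimately show ?thesis
      by (intro integrable_mult_right) (simp add: iter_convergent_def set_integrable_def M_def S_def)
  qed
  have "iter_integral (map lin_density cs) =
      (LINT t|M. (\<Sum>w\<leftarrow>product_lists cs. prod_list (map fst w) *
        (indicator S t * (\<Prod>i<length cs. snd (w ! i) (t i)))))"
    unfolding iter_integral_def set_lebesgue_integral_def
    by (simp add: prod_lin_density M_def S_def mult_ac flip: sum_list_const_mult)
  also have "\<dots> = (\<Sum>w\<leftarrow>product_lists cs. LINT t|M. prod_list (map fst w) *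
        (indicator S t * (\<Prod>i<length cs. snd (w ! i) (t i))))"
    by (rule integral_sum_list(1)) (rule intw)
  also have "\<dots> = iter_integral_lin cs"
    unfolding iter_integral_lin_def
    by (intro arg_cong[of _ _ sum_list] map_cong refl)
      (auto simp: iter_integral_def set_lebesgue_integral_def M_def S_def
        dest!: in_set_product_lists_length)
  finally show ?thesis by simp
qed

section \<open>Coordinatewise change of variables in a product measure\<close>

text \<open>A product measure is determined by its values on boxes, where the integral factors and
  the one-dimensional identity \<open>eq\<close> applies to each coordinate. Here \<open>h\<close>
  plays the part of the Jacobian and \<open>\<pi>\<close> permutes the coordinates.\<close>

lemma PiM_eq_distr_density:
  fixes h \<phi> :: "real \<Rightarrow> real" and I :: "nat set"
  assumes [simp]: "finite I" and \<pi>: "bij_betw \<pi> I I"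
    and [measurable]: "\<phi> \<in> borel_measurable borel" "h \<in> borel_measurable borel"
    and h0: "\<And>s. h s \<ge> 0"
    and L: "sigma_finite_measure L" and sets_L [measurable_cong]: "sets L = sets borel"
    and eq: "\<And>A. A \<in> sets borel \<Longrightarrow> (\<integral>\<^sup>+s. ennreal (h s) * indicator A (\<phi> s) \<partial>lborel) = emeasure L A"
  shows "Pi\<^sub>M I (\<lambda>_. L) = distr (density (Pi\<^sub>M I (\<lambda>_. lborel)) (\<lambda>t. \<Prod>i\<in>I. h (t i)))
    (Pi\<^sub>M I (\<lambda>_. lborel)) (\<lambda>t. \<lambda>i\<in>I. \<phi> (t (\<pi> i)))" (is "_ = distr (density ?M ?h) _ ?T")
proof -
  interpret L: product_sigma_finite "\<lambda>_::nat. L"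
    using L by (simp add: product_sigma_finite_def)
  interpret product_sigma_finite "\<lambda>_::nat. lborel :: real measure"
    by standard
  have \<pi>I: "\<pi> i \<in> I" if "i \<in> I" for i
    using \<pi> that by (auto simp: bij_betw_def)
  have T: "?T \<in> measurable ?M ?M"
    by (rule measurable_restrict) (use \<pi>I in measurable)
  have hm: "?h \<in> borel_measurable ?M"
    by measurable
  show ?thesis
  proof (rule L.PiM_eqI[symmetric])
    show "finite I" by simp
    show "sets (distr (density ?M ?h) ?M ?T) = sets (Pi\<^sub>M I (\<lambda>_. L))"
      by (simp add: sets_L cong: sets_PiM_cong)
    fix A assume "\<And>i. i \<in> I \<Longrightarrow> A i \<in> sets L"
    then have A: "A i \<in> sets borel" if "i \<in> I" for i using that sets_L by auto
    have AM: "Pi\<^sub>E I A \<in> sets ?M" using A by (intro sets_PiM_I_finite) auto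
    \<comment> \<open>Coordinate \<open>i\<close> of the image reads \<open>t (\<pi> i)\<close>, so
      the side \<open>A i\<close> of the box constrains the variable with index
      \<open>\<pi> i\<close>. Sorting the constraints by variable calls for the inverse permutation
      \<open>\<rho>\<close>.\<close>
    define \<rho> where "\<rho> = the_inv_into I \<pi>"
    have \<rho>: "bij_betw \<rho> I I" using bij_betw_the_inv_into[OF \<pi>] by (simp add: \<rho>_def)
    have \<rho>\<pi>: "\<rho> (\<pi> i) = i" if "i \<in> I" for i
      using \<pi> that by (simp add: \<rho>_def bij_betw_def the_inv_into_f_f)
    have \<rho>I: "\<rho> i \<in> I" if "i \<in> I" for i
      using \<rho> that by (auto simp: bij_betw_def)
    have ind: "indicator (?T -` Pi\<^sub>E I A) t = (\<Prod>i\<in>I. indicator (A (\<rho> i)) (\<phi> (t i)) :: ennreal)" for t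
    proof -
      have "(\<Prod>i\<in>I. indicator (A (\<rho> i)) (\<phi> (t i)) :: ennreal) =
          (\<Prod>i\<in>I. indicator (A (\<rho> (\<pi> i))) (\<phi> (t (\<pi> i))))"
        by (rule prod.reindex_bij_betw[OF \<pi>, symmetric])
      also have "\<dots> = (\<Prod>i\<in>I. indicator (A i) (\<phi> (t (\<pi> i))))"
        by (simp add: \<rho>\<pi> cong: prod.cong)
      also have "\<dots> = indicator (?T -` Pi\<^sub>E I A) t"
        by (auto simp: indicator_def PiE_iff prod_zero_iff)
      finally show ?thesis by simp
    qed
    have "emeasure (distr (density ?M ?h) ?M ?T) (Pi\<^sub>E I A)
        = emeasure (density ?M ?h) (?T -` Pi\<^sub>E I A \<inter> space ?M)"
      using T AM by (subst emeasure_distr) auto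
    also have "\<dots> = (\<integral>\<^sup>+t. ?h t * indicator (?T -` Pi\<^sub>E I A \<inter> space ?M) t \<partial>?M)"
      by (rule emeasure_density[OF hm]) (rule measurable_sets[OF T AM])
    also have "\<dots> = (\<integral>\<^sup>+t. (\<Prod>i\<in>I. ennreal (h (t i)) * indicator (A (\<rho> i)) (\<phi> (t i))) \<partial>?M)"
    proof (rule nn_integral_cong)
      fix t assume "t \<in> space ?M"
      then have "indicator (?T -` Pi\<^sub>E I A \<inter> space ?M) t = (indicator (?T -` Pi\<^sub>E I A) t :: ennreal)"
        by (simp add: indicator_def)
      then show "?h t * indicator (?T -` Pi\<^sub>E I A \<inter> space ?M) t =
          (\<Prod>i\<in>I. ennreal (h (t i)) * indicator (A (\<rho> i)) (\<phi> (t i)))"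
        by (simp only: ind prod.distrib) (simp add: prod_ennreal h0)
    qed
    also have "\<dots> = (\<Prod>i\<in>I. \<integral>\<^sup>+s. ennreal (h s) * indicator (A (\<rho> i)) (\<phi> s) \<partial>lborel)"
    proof (rule product_nn_integral_prod)
      fix i assume "i \<in> I"
      then have [measurable]: "A (\<rho> i) \<in> sets borel" using A \<rho>I by auto
      show "(\<lambda>s. ennreal (h s) * indicator (A (\<rho> i)) (\<phi> s)) \<in> borel_measurable lborel"
        by measurable
    qed simp
    also have "\<dots> = (\<Prod>i\<in>I. emeasure L (A (\<rho> i)))"
      using A \<rho>I by (intro prod.cong refl eq) auto
    also have "\<dots> = (\<Prod>i\<in>I. emeasure L (A i))"
      by (rule prod.reindex_bij_betw[OF \<rho>])
    finally show "emeasure (distr (density ?M ?h) ?M ?T) (Pi\<^sub>E I A) = (\<Prod>i\<in>I. emeasure L (A i))" .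
  qed
qed

section \<open>The Cayley involution and its effect on iterated integrals\<close>

definition cayley :: "real \<Rightarrow> real" where
  "cayley s = (1 - s) / (1 + s)"

text \<open>The absolute value of the derivative of \<open>cayley\<close>, cut off outside the open
  unit interval.\<close>

definition cayley_density :: "real \<Rightarrow> real" where
  "cayley_density s = indicator {0<..<1} s * (2 / (1 + s)\<^sup>2)"

lemma cayley_density_nonneg: "cayley_density s \<ge> 0"
  by (simp add: cayley_density_def)

lemma cayley_measurable [measurable]:
  "cayley \<in> borel_measurable borel" "cayley_density \<in> borel_measurable borel"
  unfolding cayley_def[abs_def] cayley_density_def[abs_def] by measurable

lemma cayley_in [simp]: "0 < s \<Longrightarrow> s < 1 \<Longrightarrow> 0 < cayley s" "0 < s \<Longrightarrow> s < 1 \<Longrightarrow> cayley s < 1"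
  by (auto simp: cayley_def)

lemma cayley_less: "0 < s \<Longrightarrow> 0 < t \<Longrightarrow> cayley s < cayley t \<longleftrightarrow> t < s"
  by (auto simp: cayley_def field_simps)

text \<open>Substitution along an increasing map: \<open>cayley\<close> decreases, so
  \<open>g\<close> is its negative, and the reflection of the line at 0 turns \<open>A\<close> into
  the set with indicator \<open>f\<close>.\<close>

lemma nn_integral_cayley:
  assumes [measurable]: "A \<in> sets borel"
  shows "(\<integral>\<^sup>+s. ennreal (cayley_density s) * indicator A (cayley s) \<partial>lborel) =
    emeasure (density lborel (indicator {0<..<1})) A"
proof -
  define g where "g = (\<lambda>s. - cayley s)"
  define f where "f = (\<lambda>x::real. indicator A (- x) :: real)"
  have [measurable]: "f \<in> borel_measurable borel" unfolding f_def by measurable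
  have g01: "g 0 = -1" "g 1 = 0" by (simp_all add: g_def cayley_def)
  have "emeasure (density lborel (indicator {0<..<1})) A =
      (\<integral>\<^sup>+x. indicator {0<..<1} x * indicator A x \<partial>lborel)"
    by (rule emeasure_density) auto
  \<comment> \<open>The substitution works on closed intervals; the added endpoints are null
    sets.\<close>
  also have "\<dots> = (\<integral>\<^sup>+x. indicator {0..1} x * indicator A x \<partial>lborel)"
  proof (rule nn_integral_cong_AE)
    have "AE x in lborel. x \<noteq> (0::real)" "AE x in lborel. x \<noteq> (1::real)"
      by (rule AE_lborel_singleton)+
    then show "AE x in lborel. indicator {0<..<1} x * indicator A x =
        (indicator {0..1} x * indicator A x :: ennreal)"
      by eventually_elim (auto simp: indicator_def)
  qed
  also have "\<dots> = (\<integral>\<^sup>+x. indicator {0..1} (- x) * indicator A (- x) \<partial>lborel)"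
    by (subst nn_integral_real_affine[where c = "-1" and t = 0]) auto
  also have "\<dots> = (\<integral>\<^sup>+x. f x * indicator {g 0..g 1} x \<partial>lborel)"
    by (intro nn_integral_cong) (auto simp: f_def g01 indicator_def)
  also have "\<dots> = (\<integral>\<^sup>+x. f (g x) * (2 / (1 + x)\<^sup>2) * indicator {0..1} x \<partial>lborel)"
  proof (rule nn_integral_substitution)
    show "set_borel_measurable borel {g 0..g 1} f"
      unfolding set_borel_measurable_def by measurable
    show "(g has_real_derivative 2 / (1 + x)\<^sup>2) (at x)" if "x \<in> {0..1}" for x
      unfolding g_def cayley_def using that
      by (auto intro!: derivative_eq_intros simp: divide_simps power2_eq_square)
    show "continuous_on {0..1} (\<lambda>x::real. 2 / (1 + x)\<^sup>2)"
      by (intro continuous_intros) auto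
  qed auto
  also have "\<dots> = (\<integral>\<^sup>+s. ennreal (cayley_density s) * indicator A (cayley s) \<partial>lborel)"
  proof (rule nn_integral_cong_AE)
    have "AE x in lborel. x \<noteq> (0::real)" "AE x in lborel. x \<noteq> (1::real)"
      by (rule AE_lborel_singleton)+
    then show "AE x in lborel. ennreal (f (g x) * (2 / (1 + x)\<^sup>2) * indicator {0..1} x) =
        ennreal (cayley_density x) * indicator A (cayley x)"
      by eventually_elim (auto simp: indicator_def f_def g_def cayley_density_def)
  qed
  finally show ?thesis ..
qed

text \<open>The integral of \<open>fs\<close> is moved to the product of Lebesgue measures on the
  open unit interval, and this product is then represented a second time through \<open>T\<close>.
  Since \<open>cayley\<close> is decreasing, \<open>T\<close> also reverses the coordinates in order
  to preserve the simplex; hence \<open>gs\<close> is matched with \<open>rev fs\<close>.\<close>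

lemma iter_integral_cayley:
  assumes meas: "\<And>f. f \<in> set fs \<Longrightarrow> f \<in> borel_measurable borel"
    and eq: "list_all2 (\<lambda>f g. \<forall>s. 0 < s \<longrightarrow> s < 1 \<longrightarrow> g s = f (cayley s) * (2 / (1 + s)\<^sup>2)) (rev fs) gs"
  shows "iter_integral fs = iter_integral gs"
proof -
  define p where "p = length fs"
  define I where "I = {..<p}"
  define M where "M = Pi\<^sub>M I (\<lambda>_. lborel :: real measure)"
  define L where "L = density lborel (indicator {0<..<1::real})"
  define F where "F = (\<lambda>t. indicator (ordered_simplex p) t * (\<Prod>i\<in>I. (fs ! i) (t i)))"
  define T where "T = (\<lambda>t. \<lambda>i\<in>I. cayley (t (p - Suc i)))"
  have [simp]: "finite I" by (simp add: I_def)
  have bij: "bij_betw (\<lambda>i. p - Suc i) I I"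
    by (rule bij_betw_byWitness[where f' = "\<lambda>i. p - Suc i"]) (auto simp: I_def)
  have F [measurable]: "F \<in> borel_measurable M"
    unfolding F_def M_def I_def p_def by (intro borel_measurable_times measurable_word meas) auto
  have T [measurable]: "T \<in> measurable M M"
    unfolding M_def T_def by (rule measurable_restrict) (auto simp: I_def)
  have ind [measurable]: "(\<lambda>t. \<Prod>i\<in>I. indicator {0<..<1} (t i) :: real) \<in> borel_measurable M"
    unfolding M_def by measurable
  have dens [measurable]: "(\<lambda>t. \<Prod>i\<in>I. cayley_density (t i) :: real) \<in> borel_measurable M"
    unfolding M_def by measurable
  have L: "sigma_finite_measure L" "sets L = sets borel"
  proof -
    have "emeasure L (space L) = 1" unfolding L_def by (subst emeasure_density) auto
    then have "finite_measure L" by (intro finite_measureI) simp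
    then show "sigma_finite_measure L" by (rule finite_measure.axioms)
  qed (simp add: L_def)
  have len: "length gs = p" using list_all2_lengthD[OF eq] by (simp add: p_def)
  \<comment> \<open>With the identity map in each coordinate this is plain restriction to the open
    unit cube.\<close>
  have P1: "Pi\<^sub>M I (\<lambda>_. L) = distr (density M (\<lambda>t. \<Prod>i\<in>I. indicator {0<..<1} (t i) :: real))
      M (\<lambda>t. \<lambda>i\<in>I. t i)"
    unfolding M_def using L
    by (intro PiM_eq_distr_density[where \<pi> = "\<lambda>i. i" and \<phi> = "\<lambda>s. s"])
      (auto simp: L_def emeasure_density ennreal_indicator bij_betw_def)
  have P2: "Pi\<^sub>M I (\<lambda>_. L) = distr (density M (\<lambda>t. \<Prod>i\<in>I. cayley_density (t i))) M T"
    unfolding M_def T_def using L bij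
    by (intro PiM_eq_distr_density) (auto simp: L_def nn_integral_cayley cayley_density_nonneg)
  have restr: "(\<lambda>t. \<lambda>i\<in>I. t i) \<in> measurable M M"
    unfolding M_def by (rule measurable_restrict) auto
  have restr_density: "(\<lambda>t. \<lambda>i\<in>I. t i) \<in> measurable (density M g) M"
    and T_density: "T \<in> measurable (density M g) M" for g
    using restr T by simp_all
  have simp_sub: "i \<in> I \<Longrightarrow> t \<in> ordered_simplex p \<Longrightarrow> 0 < t i \<and> t i < 1" for i t
    using ordered_simplexD by (auto simp: I_def)
  have "iter_integral fs = (LINT t|M. F t)"
    by (simp add: iter_integral_def set_lebesgue_integral_def F_def M_def I_def p_def)
  \<comment> \<open>Restriction to \<open>I\<close> fixes every point of \<open>space M\<close>, and
    the indicators change nothing because \<open>F\<close> vanishes outside the simplex, which lies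
    in the open cube.\<close>
  also have "\<dots> = (LINT t|M. (\<Prod>i\<in>I. indicator {0<..<1} (t i)) *\<^sub>R F (\<lambda>i\<in>I. t i))"
  proof (rule Bochner_Integration.integral_cong)
    fix t assume "t \<in> space M"
    then have "(\<lambda>i\<in>I. t i) = t" by (auto simp: M_def space_PiM)
    then show "F t = (\<Prod>i\<in>I. indicator {0<..<1} (t i)) *\<^sub>R F (\<lambda>i\<in>I. t i)"
      using simp_sub[of _ t] by (auto simp: F_def indicator_def)
  qed simp
  also have "\<dots> = (LINT t|Pi\<^sub>M I (\<lambda>_. L). F t)"
    unfolding P1 integral_distr[OF restr_density F]
    by (rule integral_density[OF measurable_compose[OF restr F] ind, symmetric])
      (auto intro!: AE_I2 prod_nonneg)
  also have "\<dots> = (LINT t|M. (\<Prod>i\<in>I. cayley_density (t i)) *\<^sub>R F (T t))"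
    unfolding P2 integral_distr[OF T_density F]
    by (rule integral_density[OF measurable_compose[OF T F] dens])
      (auto intro!: AE_I2 prod_nonneg simp: cayley_density_nonneg)
  also have "\<dots> = (LINT t|M. indicator (ordered_simplex p) t * (\<Prod>i\<in>I. (gs ! i) (t i)))"
  proof (rule Bochner_Integration.integral_cong)
    fix t assume "t \<in> space M"
    then have ext: "t \<in> extensional I" by (auto simp: M_def space_PiM PiE_iff)
    show "(\<Prod>i\<in>I. cayley_density (t i)) *\<^sub>R F (T t) =
        indicator (ordered_simplex p) t * (\<Prod>i\<in>I. (gs ! i) (t i))"
    proof (cases "\<forall>i\<in>I. 0 < t i \<and> t i < 1")
      case False
      then obtain i where i: "i \<in> I" "\<not> (0 < t i \<and> t i < 1)" by blast
      then have "(\<Prod>i\<in>I. cayley_density (t i)) = 0"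
        by (intro prod_zero bexI[of _ i]) (auto simp: cayley_density_def)
      moreover have "t \<notin> ordered_simplex p" using simp_sub[OF i(1)] i(2) by blast
      ultimately show ?thesis by simp
    next
      case True
      have t: "0 < t (p - Suc i)" "t (p - Suc i) < 1" if "i < p" for i
        using True that by (auto simp: I_def)
      have Tt: "T t i = cayley (t (p - Suc i))" if "i < p" for i
        using that by (simp add: T_def I_def)
      have "T t \<in> {..<p} \<rightarrow>\<^sub>E {0<..<1}"
        using t by (auto simp: T_def I_def)
      then have "T t \<in> ordered_simplex p \<longleftrightarrow> (\<forall>i j. i < j \<longrightarrow> j < p \<longrightarrow> T t j < T t i)"
        by (simp add: ordered_simplex_def)
      also have "\<dots> \<longleftrightarrow> (\<forall>i j. i < j \<longrightarrow> j < p \<longrightarrow> t (p - Suc i) < t (p - Suc j))"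
        by (intro all_cong1 imp_cong refl) (simp add: Tt cayley_less t)
      \<comment> \<open>The index pair \<open>i < j\<close> is replaced by
        \<open>p - Suc j < p - Suc i\<close>; this replacement is its own inverse, so the same
        instance serves both directions.\<close>
      also have "\<dots> \<longleftrightarrow> (\<forall>i j. i < j \<longrightarrow> j < p \<longrightarrow> t j < t i)"
      proof (intro iffI allI impI)
        fix i j assume H: "\<forall>i j. i < j \<longrightarrow> j < p \<longrightarrow> t (p - Suc i) < t (p - Suc j)" "i < j" "j < p"
        show "t j < t i" using H(1)[rule_format, of "p - Suc j" "p - Suc i"] H(2,3) by simp
      next
        fix i j assume H: "\<forall>i j. i < j \<longrightarrow> j < p \<longrightarrow> t j < t i" "i < j" "j < p"
        show "t (p - Suc i) < t (p - Suc j)"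
          using H(1)[rule_format, of "p - Suc j" "p - Suc i"] H(2,3) by simp
      qed
      also have "\<dots> \<longleftrightarrow> t \<in> ordered_simplex p"
        using True ext by (auto simp: ordered_simplex_def I_def PiE_iff)
      finally have S: "T t \<in> ordered_simplex p \<longleftrightarrow> t \<in> ordered_simplex p" .
      have "(\<Prod>i\<in>I. (fs ! i) (T t i)) = (\<Prod>i\<in>I. (fs ! (p - Suc i)) (T t (p - Suc i)))"
        by (rule prod.reindex_bij_betw[OF bij, symmetric])
      also have "\<dots> = (\<Prod>i\<in>I. (rev fs ! i) (cayley (t i)))"
        by (intro prod.cong) (auto simp: T_def I_def p_def rev_nth)
      finally have "(\<Prod>i\<in>I. cayley_density (t i)) * (\<Prod>i\<in>I. (fs ! i) (T t i)) =
          (\<Prod>i\<in>I. cayley_density (t i) * (rev fs ! i) (cayley (t i)))"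
        by (simp add: prod.distrib)
      also have "\<dots> = (\<Prod>i\<in>I. (gs ! i) (t i))"
        using True list_all2_nthD2[OF eq] len
        by (intro prod.cong) (auto simp: cayley_density_def I_def)
      finally show ?thesis using S by (simp add: F_def indicator_def)
    qed
  qed simp
  also have "\<dots> = iter_integral gs"
    by (simp add: iter_integral_def set_lebesgue_integral_def M_def I_def len)
  finally show ?thesis .
qed

section \<open>Convergence of words in the forms\<close>

lemma omega_measurable [measurable]:
  "omega0 \<in> borel_measurable borel" "omega s e \<in> borel_measurable borel"
  unfolding omega0_def[abs_def] omega_def[abs_def] by measurable

text \<open>For \<open>s = 1\<close> the factorisation of \<open>1 - t\<^sup>2\<close> leaves only a
  simple pole at 1; otherwise the denominator is at least 1.\<close>

lemma abs_omega_le: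
  assumes "0 < t" "t < 1"
  shows "\<bar>omega s e t\<bar> \<le> 2 / (1 - t)" and "s \<noteq> 1 \<Longrightarrow> \<bar>omega s e t\<bar> \<le> 2"
proof -
  have sq: "0 < 1 - t\<^sup>2" "1 - t \<le> 1 - t\<^sup>2"
    using assms by (auto simp: power2_eq_square mult_left_le
        power_less_one_iff[of t 2, unfolded power2_eq_square])
  have 1: "2 * t / (1 - t\<^sup>2) \<le> 2 / (1 - t)" "2 / (1 - t\<^sup>2) \<le> 2 / (1 - t)"
    using assms sq by (auto intro!: frac_le)
  have 2: "2 * t / (1 + t\<^sup>2) \<le> 2 / 1" "2 / (1 + t\<^sup>2) \<le> 2 / 1" "2 / 1 \<le> 2 / (1 - t)"
    using assms by (intro frac_le; simp)+
  show "s \<noteq> 1 \<Longrightarrow> \<bar>omega s e t\<bar> \<le> 2"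
    using 2 assms by (auto simp: omega_def abs_of_pos)
  show "\<bar>omega s e t\<bar> \<le> 2 / (1 - t)"
    using 1 2 sq assms by (auto simp: omega_def abs_of_pos)
qed

text \<open>Only \<open>omega0\<close> is singular at 0 and only the forms with \<open>s = 1\<close>
  are singular at 1. All these poles are simple, and the constant 2 bounds every letter, so the
  behaviour of the two end letters decides.\<close>

lemma iter_convergent_omega_word:
  assumes len: "length fs \<ge> 2"
    and letters: "\<forall>f\<in>set fs. f = omega0 \<or> (\<exists>s e. f = omega s e)"
    and first: "hd fs = omega0 \<or> (\<exists>s e. s \<noteq> 1 \<and> hd fs = omega s e)"
    and last: "\<exists>s e. last fs = omega s e"
  shows "iter_convergent fs"
proof (rule iter_convergentI[where C = 2])
  show "f \<in> borel_measurable borel" if "f \<in> set fs" for f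
    using letters that by auto
  fix t :: real assume t: "0 < t" "t < 1"
  have omega0: "\<bar>omega0 t\<bar> \<le> 2 / t" and two: "2 \<le> 2 / t"
    using t by (simp_all add: omega0_def field_simps)
  show "\<bar>hd fs t\<bar> \<le> 2 / t"
    using first omega0 order_trans[OF abs_omega_le(2)[OF t] two] by auto
  show "\<bar>last fs t\<bar> \<le> 2 / (1 - t)"
    using last abs_omega_le(1)[OF t] by auto
  have "2 / (1 - t) \<le> 2 / (t * (1 - t))" "2 / t \<le> 2 / (t * (1 - t))"
    using t by (auto intro!: divide_left_mono simp: mult_left_le mult_left_le_one_le)
  note le = order_trans[OF abs_omega_le(1)[OF t] this(1)] order_trans[OF omega0 this(2)]
  show "\<bar>f t\<bar> \<le> 2 / (t * (1 - t))" if "f \<in> set fs" for f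
    using letters that le by auto
qed (rule len)

section \<open>Transformation of the letters\<close>

lemma lin_density_u0:
  assumes "0 < t" "t < 1"
  shows "lin_density u0 t = omega0 (cayley t) * (2 / (1 + t)\<^sup>2)"
proof -
  have nz: "1 - t \<noteq> 0" "1 + t \<noteq> 0" using assms by linarith+
  have "lin_density u0 t = 2 / (1 - t\<^sup>2)"
    by (simp add: lin_density_def u0_def omega_def)
  also have "\<dots> = 2 / ((1 - t) * (1 + t))"
    by (simp add: power2_eq_square algebra_simps)
  also have "\<dots> = omega0 (cayley t) * (2 / (1 + t)\<^sup>2)"
    using nz by (simp add: omega0_def cayley_def power2_eq_square divide_simps)
  finally show ?thesis .
qed

text \<open>Multiplication by \<open>(1 + t)\<^sup>2\<close> turns the denominators
  \<open>1 - (cayley t)\<^sup>2\<close> and \<open>1 + (cayley t)\<^sup>2\<close> into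
  \<open>4 * t\<close> and \<open>2 * (1 + t\<^sup>2)\<close>. For \<open>e \<noteq> 1\<close> the
  result is a single form; for \<open>e = 1\<close> the numerator contributes a further
  \<open>1 + t\<close> below, and partial fractions give the combinations in
  \<open>u\<close>.\<close>

lemma lin_density_u:
  assumes "0 < t" "t < 1"
  shows "lin_density (u s e) t = omega s e (cayley t) * (2 / (1 + t)\<^sup>2)"
proof -
  have pos: "0 < 1 - t" "0 < 1 + t" "0 < 1 + t\<^sup>2"
    using assms by (auto simp: add_pos_nonneg)
  then have nz: "t \<noteq> 0" "1 - t \<noteq> 0" "1 + t \<noteq> 0" "1 + t\<^sup>2 \<noteq> 0"
    using assms by linarith+
  \<comment> \<open>The pole at -1 that partial fractions produce is not itself a letter; it is the
    difference of the two forms with \<open>s = 1\<close>.\<close>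
  have "2 / (1 + t) = (2 - 2 * t) / ((1 - t) * (1 + t))"
    using nz by (simp add: divide_simps)
  also have "(1 - t) * (1 + t) = 1 - t\<^sup>2"
    by (simp add: power2_eq_square algebra_simps)
  finally have red: "2 / (1 + t) = 2 / (1 - t\<^sup>2) - 2 * t / (1 - t\<^sup>2)"
    by (simp only: diff_divide_distrib)
  have c: "cayley t * (1 + t) = 1 - t" using nz by (simp add: cayley_def)
  have "(1 - (cayley t)\<^sup>2) * (1 + t)\<^sup>2 = (1 + t)\<^sup>2 - (cayley t * (1 + t))\<^sup>2"
    "(1 + (cayley t)\<^sup>2) * (1 + t)\<^sup>2 = (1 + t)\<^sup>2 + (cayley t * (1 + t))\<^sup>2"
    by algebra+
  then have "(1 - (cayley t)\<^sup>2) * (1 + t)\<^sup>2 = 4 * t"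
    "(1 + (cayley t)\<^sup>2) * (1 + t)\<^sup>2 = 2 * (1 + t\<^sup>2)"
    unfolding c by (simp_all add: power2_eq_square algebra_simps)
  then have c2: "1 - (cayley t)\<^sup>2 = 4 * t / (1 + t)\<^sup>2"
    "1 + (cayley t)\<^sup>2 = 2 * (1 + t\<^sup>2) / (1 + t)\<^sup>2"
    using nz by (simp_all add: eq_divide_eq)
  have q: "x / (y / (1 + t)\<^sup>2) * (2 / (1 + t)\<^sup>2) = 2 * x / y" for x y
    using nz by simp
  consider "e = 1" "s = 1" | "e = 1" "s \<noteq> 1" | "e \<noteq> 1" "s = 1" | "e \<noteq> 1" "s \<noteq> 1" by blast
  then show ?thesis
  proof cases
    case 1
    then have "omega s e (cayley t) * (2 / (1 + t)\<^sup>2) = 2 * (2 * cayley t) / (4 * t)"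
      by (simp only: omega_def c2 q if_True if_False simp_thms)
    also have "\<dots> = 1 / t - 2 / (1 + t)"
      using nz by (simp add: cayley_def divide_simps) algebra
    also have "\<dots> = lin_density (u s e) t"
      using 1 by (simp add: lin_density_def u_def omega_def omega0_def red)
    finally show ?thesis by simp
  next
    case 2
    then have "omega s e (cayley t) * (2 / (1 + t)\<^sup>2) = 2 * (- 2 * cayley t) / (2 * (1 + t\<^sup>2))"
      by (simp only: omega_def c2 q if_True if_False simp_thms)
    also have "\<dots> = 2 * t / (1 + t\<^sup>2) - 2 / (1 + t)"
      using nz by (simp add: cayley_def divide_simps) algebra
    also have "\<dots> = lin_density (u s e) t"
      using 2 by (simp add: lin_density_def u_def omega_def red)
    finally show ?thesis by simp
  next
    case 3
    then have "omega s e (cayley t) * (2 / (1 + t)\<^sup>2) = 2 * 2 / (4 * t)"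
      by (simp only: omega_def c2 q if_True if_False simp_thms)
    then show ?thesis
      using 3 by (simp add: lin_density_def u_def omega0_def)
  next
    case 4
    then have "omega s e (cayley t) * (2 / (1 + t)\<^sup>2) = 2 * (- 2) / (2 * (1 + t\<^sup>2))"
      by (simp only: omega_def c2 q if_True if_False simp_thms)
    also have "\<dots> = - 2 / (1 + t\<^sup>2)"
      by (rule mult_divide_mult_cancel_left) simp
    also have "\<dots> = lin_density (u s e) t"
      using 4 by (simp add: lin_density_def u_def omega_def)
    finally show ?thesis by simp
  qed
qed

section \<open>The two words of the identity\<close>

lemma list_all2_concat_map:
  assumes "\<And>x. x \<in> set xs \<Longrightarrow> list_all2 P (f x) (g x)"
  shows "list_all2 P (concat (map f xs)) (concat (map g xs))"
  using assms by (induction xs) (auto intro: list_all2_appendI)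

lemma lhs_word_letters: "f \<in> set (lhs_word r k l \<sigma> \<epsilon>) \<Longrightarrow> f = omega0 \<or> (\<exists>s e. f = omega s e)"
  by (auto simp: lhs_word_def split: if_splits)

text \<open>The word opens with \<open>omega0\<close> from block \<open>r\<close> and closes with an
  \<open>omega\<close> from block 1, so its ends have no pole at 1 and at 0 respectively.\<close>

lemma iter_convergent_lhs_word:
  assumes "r \<ge> 1" "k r \<ge> 1" "l r \<ge> 1" "l 1 \<ge> 1"
  shows "iter_convergent (lhs_word r k l \<sigma> \<epsilon>)"
proof (rule iter_convergent_omega_word)
  have *: "lhs_word r k l \<sigma> \<epsilon> =
      (replicate (k r) omega0 @ replicate (l r) (omega (\<sigma> r) (\<epsilon> r))) @ lhs_word (r - 1) k l \<sigma> \<epsilon>"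
    using assms(1) by (cases r) (simp_all add: lhs_word_def)
  show "length (lhs_word r k l \<sigma> \<epsilon>) \<ge> 2" "hd (lhs_word r k l \<sigma> \<epsilon>) = omega0 \<or>
      (\<exists>s e. s \<noteq> 1 \<and> hd (lhs_word r k l \<sigma> \<epsilon>) = omega s e)"
    using assms by (auto simp: * hd_append)
  have "[1..<Suc r] = 1 # [2..<Suc r]"
    using assms(1) by (simp add: upt_conv_Cons numeral_2_eq_2)
  then have "last (lhs_word r k l \<sigma> \<epsilon>) = omega (\<sigma> 1) (\<epsilon> 1)"
    using assms by (simp add: lhs_word_def last_append)
  then show "\<exists>s e. last (lhs_word r k l \<sigma> \<epsilon>) = omega s e" by blast
qed (use lhs_word_letters in blast)

lemma rhs_word_letters: "c \<in> set (rhs_word r k l \<sigma> \<epsilon>) \<Longrightarrow> c = u0 \<or> (\<exists>s e. c = u s e)"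
  by (auto simp: rhs_word_def split: if_splits)

lemma u_letters:
  "x \<in> set u0 \<Longrightarrow> snd x = omega0 \<or> (\<exists>s e. snd x = omega s e)"
  "x \<in> set (u s e) \<Longrightarrow> snd x = omega0 \<or> (\<exists>s e. snd x = omega s e)"
   apply (simp add: u0_def, blast)
  by (auto simp: u_def split: if_splits) blast+

text \<open>Every expanded word ends in \<open>omega 1 (-1)\<close>, the sole summand of
  \<open>u0\<close>, which is regular at 0. The condition on \<open>\<epsilon> 1\<close> makes the
  first letter \<open>omega0\<close> or \<open>omega (-1) (-1)\<close>, both regular at 1; the
  summands of \<open>u\<close> for upper index 1 include forms with a pole there.\<close>

lemma iter_convergent_rhs_word:
  assumes "r \<ge> 1" "k r \<ge> 1" "l r \<ge> 1" "l 1 \<ge> 1" "\<epsilon> 1 = -1"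
  shows "iter_convergent_lin (rhs_word r k l \<sigma> \<epsilon>)"
  unfolding iter_convergent_lin_def
proof
  let ?cs = "rhs_word r k l \<sigma> \<epsilon>"
  fix w assume "w \<in> set (product_lists ?cs)"
  then have w: "list_all2 (\<lambda>x ys. x \<in> set ys) w ?cs" by (simp add: product_lists_set)
  have *: "?cs = rhs_word (r - 1) k l \<sigma> \<epsilon> @ replicate (l r) (u (\<sigma> r) (\<epsilon> r)) @ replicate (k r) u0"
    using assms(1) by (cases r) (simp_all add: rhs_word_def)
  have len: "length w = length ?cs" "length ?cs \<ge> 2"
    using list_all2_lengthD[OF w] assms by (auto simp: *)
  then have ne: "w \<noteq> []" "?cs \<noteq> []" by auto
  have "last ?cs = u0" using assms by (simp add: * last_append)
  moreover have "last w \<in> set (last ?cs)"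
    using list_all2_nthD[OF w, of "length w - 1"] len ne by (simp add: last_conv_nth)
  ultimately have last: "snd (last w) = omega 1 (-1)" by (simp add: u0_def)
  have "[1..<Suc r] = 1 # [2..<Suc r]"
    using assms(1) by (simp add: upt_conv_Cons numeral_2_eq_2)
  then have "hd ?cs = u (\<sigma> 1) (\<epsilon> 1)"
    using assms by (simp add: rhs_word_def hd_append)
  moreover have "hd w \<in> set (hd ?cs)"
    using list_all2_nthD[OF w, of 0] len ne by (simp add: hd_conv_nth)
  ultimately have hd: "snd (hd w) = omega0 \<or> snd (hd w) = omega (-1) (-1)"
    using assms(5) by (auto simp: u_def split: if_splits)
  have letters: "snd x = omega0 \<or> (\<exists>s e. snd x = omega s e)" if x: "x \<in> set w" for x
  proof -
    obtain i where "i < length w" "x = w ! i"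
      using x by (auto simp: in_set_conv_nth)
    then have c: "?cs ! i \<in> set ?cs" and x: "x \<in> set (?cs ! i)"
      using list_all2_nthD[OF w] len by auto
    from c have "?cs ! i = u0 \<or> (\<exists>s e. ?cs ! i = u s e)"
      by (rule rhs_word_letters)
    then show ?thesis
      using x by (metis u_letters)
  qed
  show "iter_convergent (map snd w)"
  proof (rule iter_convergent_omega_word)
    show "hd (map snd w) = omega0 \<or> (\<exists>s e. s \<noteq> 1 \<and> hd (map snd w) = omega s e)"
    proof -
      have "(-1::int) \<noteq> 1" by simp
      then show ?thesis using hd unfolding hd_map[OF ne(1)] by blast
    qed
    show "\<exists>s e. last (map snd w) = omega s e"
      using last ne by (auto simp: last_map)
  qed (use len letters in auto)
qed

theorem theorem3p7:
  fixes r :: nat and k l :: "nat \<Rightarrow> nat" and \<sigma> \<epsilon> :: "nat \<Rightarrow> int"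
  assumes "r \<ge> 1"
    and "\<forall>i\<in>{1..r}. k i \<ge> 1"
    and "\<forall>i\<in>{1..r}. l i \<ge> 1"
    and "\<forall>i\<in>{1..r}. \<sigma> i \<in> {1, -1}"
    and "\<forall>i\<in>{1..r}. \<epsilon> i \<in> {1, -1}"
    and "\<epsilon> 1 = -1"
  shows "iter_convergent (lhs_word r k l \<sigma> \<epsilon>)
    \<and> iter_convergent_lin (rhs_word r k l \<sigma> \<epsilon>)
    \<and> iter_integral (lhs_word r k l \<sigma> \<epsilon>) = iter_integral_lin (rhs_word r k l \<sigma> \<epsilon>)"
proof (intro conjI)
  have kl: "k r \<ge> 1" "l r \<ge> 1" "l 1 \<ge> 1"
    using assms(1-3) by auto
  show "iter_convergent (lhs_word r k l \<sigma> \<epsilon>)"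
    using assms(1) kl by (rule iter_convergent_lhs_word)
  show conv: "iter_convergent_lin (rhs_word r k l \<sigma> \<epsilon>)"
    using assms(1) kl assms(6) by (rule iter_convergent_rhs_word)
  \<comment> \<open>Reversal restores the increasing order of the blocks and swaps the two halves of
    each, which aligns the word letter by letter with \<open>rhs_word\<close>.\<close>
  have rev: "rev (lhs_word r k l \<sigma> \<epsilon>) =
      concat (map (\<lambda>i. replicate (l i) (omega (\<sigma> i) (\<epsilon> i)) @ replicate (k i) omega0) [1..<Suc r])"
    by (simp add: lhs_word_def rev_concat rev_map comp_def del: upt_Suc)
  have "iter_integral (lhs_word r k l \<sigma> \<epsilon>) =
      iter_integral (map lin_density (rhs_word r k l \<sigma> \<epsilon>))"
  proof (rule iter_integral_cayley)
    show "f \<in> borel_measurable borel" if "f \<in> set (lhs_word r k l \<sigma> \<epsilon>)" for f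
      using lhs_word_letters[OF that] by auto
    show "list_all2 (\<lambda>f g. \<forall>s. 0 < s \<longrightarrow> s < 1 \<longrightarrow> g s = f (cayley s) * (2 / (1 + s)\<^sup>2))
        (rev (lhs_word r k l \<sigma> \<epsilon>)) (map lin_density (rhs_word r k l \<sigma> \<epsilon>))"
      unfolding rev rhs_word_def list_all2_map2
      by (intro list_all2_concat_map list_all2_appendI)
        (auto simp: list_all2_conv_all_nth lin_density_u lin_density_u0)
  qed
  also have "\<dots> = iter_integral_lin (rhs_word r k l \<sigma> \<epsilon>)"
    by (rule iter_integral_lin_eq[OF conv, symmetric])
  finally show "iter_integral (lhs_word r k l \<sigma> \<epsilon>) = iter_integral_lin (rhs_word r k l \<sigma> \<epsilon>)" .
qed

end
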